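(* Let $l,\alpha,k>0$. For each $0\neq\lambda\in\mathbb{R}\setminus\operatorname{Spec}\mathcal{K}_{\mathbf{Q}}$, there exists $\mathbf{M}\in\mathrm{wp}(4,8,\mathbb{R})$ such that $\lambda\in\operatorname{Spec}\mathcal{K}_{\mathbf{M}}$.
   Context: Fix $l,\alpha,k>0$. $\mathrm{gl}(m,n,\mathbb{C})$ is the set of complex $m\times n$ matrices, $\mathrm{gl}(n,\mathbb{C})=\mathrm{gl}(n,n,\mathbb{C})$; $L^2[-l,l]$ is the Hilbert space of complex-valued square-integrable functions. $\operatorname{Spec}$ of an operator denotes its set of (complex) eigenvalues. Matrices. $\omega_j=e^{\sqrt{-1}\,\frac{\pi}{4}(2j-1)}$ ($j\in\mathbb{Z}$), $\mathbf{\Omega}=\mathrm{diag}(\omega_1,\omega_2,\omega_3,\omega_4)$, and $\mathbf{L}^2=\begin{pmatrix}0&0&1&0\\0&0&0&1\\1&0&0&0\\0&1&0&0\end{pmatrix}$. Let $\mathbf{y}(x)=(e^{\omega_1\alpha x},e^{\omega_2\alpha x},e^{\omega_3\alpha x},e^{\omega_4\alpha x})^T$ and $\mathbf{W}(x)=\left((\omega_q\alpha)^{p-1}e^{\omega_q\alpha x}\right)_{1\le p,q\le 4}$ (row index $p$, column index $q$), which is invertible for every $x$. Well-posedness. Write $\mathbf{M}=(\mathbf{M}^-\ \mathbf{M}^+)\in\mathrm{gl}(4,8,\mathbb{C})$ with $\mathbf{M}^\pm\in\mathrm{gl}(4,\mathbb{C})$. For $u\in C^3[-l,l]$, $\mathcal{B}[u]=(u(-l),u'(-l),u''(-l),u'''(-l),u(l),u'(l),u''(l),u'''(l))^T$.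 $\mathbf{M}$ is well-posed if $u=0$ is the only solution of $u^{(4)}+\alpha^4u=0$ on $[-l,l]$ with $\mathbf{M}\cdot\mathcal{B}[u]=\mathbf{0}$; $\mathrm{wp}(4,8,\mathbb{C})$ is the set of well-posed matrices, and $\mathrm{wp}(4,8,\mathbb{R})$ is the set of well-posed matrices with real entries. Put $\widetilde{\mathbf{M}}^-=\mathbf{M}^-\mathbf{W}(-l)$, $\widetilde{\mathbf{M}}^+=\mathbf{M}^+\mathbf{W}(l)$, $\widetilde{\mathbf{M}}=\widetilde{\mathbf{M}}^-+\widetilde{\mathbf{M}}^+$ (invertible when $\mathbf{M}$ is well-posed). For well-posed $\mathbf{M}$ let $\mathbf{G}_{\mathbf{M}}^\pm=\widetilde{\mathbf{M}}^{-1}\widetilde{\mathbf{M}}^\pm\mathbf{\Omega}\mathbf{L}^2$. Operator. The Green's function is $G_{\mathbf{M}}(x,\xi)=\frac{\alpha}{4k}\mathbf{y}(x)^T\mathbf{G}_{\mathbf{M}}^+\mathbf{y}(\xi)$ if $x\le\xi$ and $-\frac{\alpha}{4k}\mathbf{y}(x)^T\mathbf{G}_{\mathbf{M}}^-\mathbf{y}(\xi)$ if $\xi\le x$, and $\mathcal{K}_{\mathbf{M}}:L^2[-l,l]\to L^2[-l,l]$ is $\mathcal{K}_{\mathbf{M}}[w](x)=\int_{-l}^lG_{\mathbf{M}}(x,\xi)w(\xi)\,d\xi$. (Equivalently, $\mathcal{K}_{\mathbf{M}}[w]$ is the unique solution of $u^{(4)}+\alpha^4u=\frac{\alpha^4}{k}w$,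 $\mathbf{M}\cdot\mathcal{B}[u]=\mathbf{0}$.) The matrix $\mathbf{Q}=\left(\begin{array}{cccc|cccc}0&\alpha^2&-\sqrt2\alpha&1&0&0&0&0\\ \sqrt2\alpha^3&-\alpha^2&0&1&0&0&0&0\\0&0&0&0&0&\alpha^2&\sqrt2\alpha&1\\0&0&0&0&-\sqrt2\alpha^3&-\alpha^2&0&1\end{array}\right)$ is well-posed. *)

theory Defs
  imports "HOL-Analysis.Analysis"
begin

text \<open>
  Rows and columns carry the index type \<open>4\<close>, whose elements are taken in the order
  \<open>1, 2, 3, 4\<close> (note \<open>4 = 0\<close> in this type; this is also the order of \<^const>\<open>vector\<close>).
  \<open>pos\<close> turns such an index into the natural number between 1 and 4.
\<close>

definition pos :: "4 \<Rightarrow> nat" where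
  "pos p = (if p = 1 then 1 else if p = 2 then 2 else if p = 3 then 3 else 4)"

definition omega :: "int \<Rightarrow> complex" where
  "omega j = exp (\<i> * of_real (pi / 4) * of_int (2 * j - 1))"

definition Omega :: "complex^4^4" where
  "Omega = (\<chi> p q. if p = q then omega (int (pos p)) else 0)"

definition L_sq :: "complex^4^4" where
  "L_sq = vector [vector [0, 0, 1, 0],
                  vector [0, 0, 0, 1],
                  vector [1, 0, 0, 0],
                  vector [0, 1, 0, 0]]"

definition y_vec :: "real \<Rightarrow> real \<Rightarrow> complex^4" where
  "y_vec \<alpha> x = (\<chi> q. exp (omega (int (pos q)) * of_real \<alpha> * of_real x))"

definition W :: "real \<Rightarrow> real \<Rightarrow> complex^4^4" where
  "W \<alpha> x = (\<chi> p q. (omega (int (pos q)) * of_real \<alpha>) ^ (pos p - 1)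
                     * exp (omega (int (pos q)) * of_real \<alpha> * of_real x))"

text \<open>
  A 4 by 8 matrix \<open>(M\<^sup>- M\<^sup>+)\<close> has its columns indexed by the 8-element type \<open>4 + 4\<close>:
  the \<^const>\<open>Inl\<close> columns form \<open>M\<^sup>-\<close> and the \<^const>\<open>Inr\<close> columns form \<open>M\<^sup>+\<close>.
\<close>

type_synonym mat48 = "complex^(4 + 4)^4"

definition left_block :: "mat48 \<Rightarrow> complex^4^4" where
  "left_block M = (\<chi> i j. M $ i $ Inl j)"

definition right_block :: "mat48 \<Rightarrow> complex^4^4" where
  "right_block M = (\<chi> i j. M $ i $ Inr j)"

definition join_blocks :: "complex^4^4 \<Rightarrow> complex^4^4 \<Rightarrow> mat48" where
  "join_blocks A B = (\<chi> i j. case j of Inl q \<Rightarrow> A $ i $ q | Inr q \<Rightarrow> B $ i $ q)"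

text \<open>Derivatives on \<open>[-l, l]\<close> are one-sided at the end points.\<close>

definition nderiv :: "real \<Rightarrow> nat \<Rightarrow> (real \<Rightarrow> complex) \<Rightarrow> real \<Rightarrow> complex" where
  "nderiv l n = ((\<lambda>f x. vector_derivative f (at x within {-l..l})) ^^ n)"

definition C_on :: "real \<Rightarrow> nat \<Rightarrow> (real \<Rightarrow> complex) set" where
  "C_on l n = {u. (\<forall>i<n. nderiv l i u differentiable_on {-l..l}) \<and>
                  continuous_on {-l..l} (nderiv l n u)}"

definition bdry :: "real \<Rightarrow> (real \<Rightarrow> complex) \<Rightarrow> complex^(4 + 4)" where
  "bdry l u = (\<chi> j. case j of Inl p \<Rightarrow> nderiv l (pos p - 1) u (-l)
                            | Inr p \<Rightarrow> nderiv l (pos p - 1) u l)"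

definition wp :: "real \<Rightarrow> real \<Rightarrow> mat48 set" where
  "wp l \<alpha> = {M. \<forall>u \<in> C_on l 4.
      (\<forall>x\<in>{-l..l}. nderiv l 4 u x + of_real (\<alpha> ^ 4) * u x = 0) \<and> M *v bdry l u = 0
      \<longrightarrow> (\<forall>x\<in>{-l..l}. u x = 0)}"

definition wp_real :: "real \<Rightarrow> real \<Rightarrow> mat48 set" where
  "wp_real l \<alpha> = {M \<in> wp l \<alpha>. \<forall>i j. M $ i $ j \<in> \<real>}"

definition M_tilde_minus :: "real \<Rightarrow> real \<Rightarrow> mat48 \<Rightarrow> complex^4^4" where
  "M_tilde_minus l \<alpha> M = left_block M ** W \<alpha> (-l)"

definition M_tilde_plus :: "real \<Rightarrow> real \<Rightarrow> mat48 \<Rightarrow> complex^4^4" where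
  "M_tilde_plus l \<alpha> M = right_block M ** W \<alpha> l"

definition M_tilde :: "real \<Rightarrow> real \<Rightarrow> mat48 \<Rightarrow> complex^4^4" where
  "M_tilde l \<alpha> M = M_tilde_minus l \<alpha> M + M_tilde_plus l \<alpha> M"

text \<open>
  The matrices below are meaningful for well-posed \<open>M\<close> only: \<^const>\<open>matrix_inv\<close> is
  unspecified on singular matrices.
\<close>

definition G_minus :: "real \<Rightarrow> real \<Rightarrow> mat48 \<Rightarrow> complex^4^4" where
  "G_minus l \<alpha> M = matrix_inv (M_tilde l \<alpha> M) ** M_tilde_minus l \<alpha> M ** Omega ** L_sq"

definition G_plus :: "real \<Rightarrow> real \<Rightarrow> mat48 \<Rightarrow> complex^4^4" where
  "G_plus l \<alpha> M = matrix_inv (M_tilde l \<alpha> M) ** M_tilde_plus l \<alpha> M ** Omega ** L_sq"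

text \<open>The form \<open>v\<^sup>T A w\<close>, without complex conjugation.\<close>

definition bilin :: "complex^4 \<Rightarrow> complex^4^4 \<Rightarrow> complex^4 \<Rightarrow> complex" where
  "bilin v A w = (\<Sum>p\<in>UNIV. v $ p * (A *v w) $ p)"

text \<open>
  For well-posed \<open>M\<close> the two branches agree at \<open>x = \<xi>\<close>, because
  \<open>G_plus + G_minus = Omega ** L_sq\<close> and the sum of the four \<open>omega q\<close> vanishes.
\<close>

definition green :: "real \<Rightarrow> real \<Rightarrow> real \<Rightarrow> mat48 \<Rightarrow> real \<Rightarrow> real \<Rightarrow> complex" where
  "green l \<alpha> k M x \<xi> =
     (if x \<le> \<xi>
      then of_real (\<alpha> / (4 * k)) * bilin (y_vec \<alpha> x) (G_plus l \<alpha> M) (y_vec \<alpha> \<xi>)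
      else - of_real (\<alpha> / (4 * k)) * bilin (y_vec \<alpha> x) (G_minus l \<alpha> M) (y_vec \<alpha> \<xi>))"

definition K_op :: "real \<Rightarrow> real \<Rightarrow> real \<Rightarrow> mat48 \<Rightarrow> (real \<Rightarrow> complex) \<Rightarrow> real \<Rightarrow> complex" where
  "K_op l \<alpha> k M w x = (LINT \<xi> | lebesgue_on {-l..l}. green l \<alpha> k M x \<xi> * w \<xi>)"

text \<open>
  Elements of \<open>L\<^sup>2[-l, l]\<close> are represented by square-integrable functions; equality in
  \<open>L\<^sup>2\<close> is equality almost everywhere on \<open>[-l, l]\<close>.
\<close>

definition L2 :: "real \<Rightarrow> (real \<Rightarrow> complex) set" where
  "L2 l = {w \<in> borel_measurable (lebesgue_on {-l..l}).
             integrable (lebesgue_on {-l..l}) (\<lambda>x. (norm (w x))\<^sup>2)}"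

definition Spec :: "real \<Rightarrow> ((real \<Rightarrow> complex) \<Rightarrow> real \<Rightarrow> complex) \<Rightarrow> complex set" where
  "Spec l T = {\<mu>. \<exists>w \<in> L2 l. \<not> (AE x in lebesgue_on {-l..l}. w x = 0) \<and>
                   (AE x in lebesgue_on {-l..l}. T w x = \<mu> * w x)}"

definition Q :: "real \<Rightarrow> mat48" where
  "Q \<alpha> = (let a = complex_of_real \<alpha>; s = complex_of_real (sqrt 2) in
     join_blocks
       (vector [vector [0, a^2, - s * a, 1],
                vector [s * a^3, - (a^2), 0, 1],
                vector [0, 0, 0, 0],
                vector [0, 0, 0, 0]])
       (vector [vector [0, 0, 0, 0],
                vector [0, 0, 0, 0],
                vector [0, a^2, s * a, 1],
                vector [- s * a^3, - (a^2), 0, 1]]))"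

end

theory Submission imports Defs begin

text \<open>
  An eigenfunction of \<open>K_M\<close> for \<open>\<mu> \<noteq> 0\<close> is a solution \<open>u\<close> of \<open>u'''' = c u\<close> with
  \<open>c = \<alpha>^4 / (k \<mu>) - \<alpha>^4 \<noteq> - \<alpha>^4\<close> whose boundary data lie in the kernel of \<open>M\<close>, so it suffices to
  find a real \<open>u\<close> whose boundary data are not those of a solution of \<open>v'''' = - \<alpha>^4 v\<close>: then some real
  \<open>M\<close> annihilates the former and is injective on the latter. Put \<open>a(x) = W(x)\<inverse> U(x)\<close>, where
  \<open>U = (u, u', u'', u''')\<close>; the boundary data of \<open>u\<close> come from such a \<open>v\<close> iff \<open>a(l) = a(-l)\<close>. For
  \<open>u = e^(\<beta> x)\<close>, \<open>\<beta>^4 = c\<close>, the entry \<open>a_q\<close> is a nonzero multiple of \<open>e^((\<beta> - \<mu>_q) x)\<close>, where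
  \<open>\<mu>_q = \<omega>_q \<alpha>\<close>; as \<open>Re \<mu>_q\<close> takes two values, \<open>a(l) \<noteq> a(-l)\<close>, and this persists for the real or
  the imaginary part of \<open>u\<close>. The same \<open>a\<close> satisfies \<open>- \<mu> a' = (\<alpha> / 4k) u \<Omega> L\<^sup>2 y\<close>, so the Green's
  function integral is evaluated by the fundamental theorem of calculus.
\<close>

section \<open>Fourth roots of -1 and the characteristic exponents\<close>

lemma omega_1_power4: "omega 1 ^ 4 = -1"
proof -
  have "omega 1 ^ 4 = exp (\<i> * of_real pi)"
    unfolding omega_def exp_of_nat_mult[symmetric] by (simp add: field_simps)
  then show ?thesis by (simp add: exp_pi_i')
qed

lemma omega_add_1: "omega (j + 1) = \<i> * omega j"
proof -
  have "omega (j + 1) = exp (\<i> * of_real (pi / 4) * of_int (2 * j - 1) + \<i> * of_real pi / 2)"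
    unfolding omega_def by (simp add: field_simps)
  then show ?thesis
    unfolding exp_add omega_def by (simp add: cis_conv_exp[symmetric] exp_eq_polar)
qed

lemma omega_2: "omega 2 = \<i> * omega 1" and omega_3: "omega 3 = - omega 1"
  and omega_4: "omega 4 = - \<i> * omega 1"
  using omega_add_1[of 1] omega_add_1[of 2] omega_add_1[of 3] by simp_all

lemma omega_nonzero: "omega j \<noteq> 0"
  by (simp add: omega_def)

lemma Re_omega_1: "Re (omega 1) > 0"
  by (simp add: omega_def exp_eq_polar cos_45)

lemma pos_simps [simp]: "pos 1 = 1" "pos 2 = 2" "pos 3 = 3" "pos 4 = 4"
  by (simp_all add: pos_def)

lemma vector_4 [simp]:
  "(vector [a, b, c, d] :: 'a::zero^4) $ 1 = a"
  "(vector [a, b, c, d] :: 'a::zero^4) $ 2 = b"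
  "(vector [a, b, c, d] :: 'a::zero^4) $ 3 = c"
  "(vector [a, b, c, d] :: 'a::zero^4) $ 4 = d"
  unfolding vector_def by simp_all

definition mu :: "real \<Rightarrow> 4 \<Rightarrow> complex" where
  "mu \<alpha> q = omega (int (pos q)) * of_real \<alpha>"

lemma omega_pos_power4: "omega (int (pos q)) ^ 4 = -1"
  using exhaust_4[of q]
  by (auto simp: omega_2 omega_3 omega_4 power_mult_distrib omega_1_power4)

lemma mu_power4: "mu \<alpha> q ^ 4 = - of_real (\<alpha> ^ 4)"
  by (simp add: mu_def power_mult_distrib omega_pos_power4)

lemma mu_nonzero: "\<alpha> \<noteq> 0 \<Longrightarrow> mu \<alpha> q \<noteq> 0"
  by (simp add: mu_def omega_nonzero)

lemma W_nth: "W \<alpha> x $ p $ q = mu \<alpha> q ^ (pos p - 1) * exp (mu \<alpha> q * of_real x)"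
  by (simp add: W_def mu_def)

lemma y_vec_nth: "y_vec \<alpha> x $ q = exp (mu \<alpha> q * of_real x)"
  by (simp add: y_vec_def mu_def)

section \<open>The inverse of the Wronskian matrix\<close>

text \<open>
  The inverse of the Wronskian matrix: its rows are the factors
  \<open>(z^4 + \<alpha>^4) / (z - \<mu>_q) = z^3 + \<mu>_q z^2 + \<mu>_q^2 z + \<mu>_q^3\<close> of the characteristic polynomial,
  normalised by their value \<open>4 \<mu>_q^3\<close> at \<open>z = \<mu>_q\<close>.
\<close>

definition W_inv :: "real \<Rightarrow> real \<Rightarrow> complex^4^4" where
  "W_inv \<alpha> x = (\<chi> q p. exp (- mu \<alpha> q * of_real x) * mu \<alpha> q ^ (4 - pos p) / (4 * mu \<alpha> q ^ 3))"

text \<open>The exponentials cancel, and entry (i, j) is a quarter of the sum over q of the powers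
  \<open>mu \<alpha> q\<close>^(i-j). The four \<open>mu \<alpha> q\<close> are a fixed number times
  the fourth roots of unity and |i-j| < 4, so the sum vanishes unless i = j.\<close>

lemma W_mult_W_inv:
  assumes "\<alpha> \<noteq> 0"
  shows "W \<alpha> x ** W_inv \<alpha> x = mat 1"
proof -
  define m where "m = mu \<alpha> 1"
  have m0: "m \<noteq> 0" using assms by (simp add: m_def mu_nonzero)
  have mu: "mu \<alpha> 1 = m" "mu \<alpha> 2 = \<i> * m" "mu \<alpha> 3 = - m" "mu \<alpha> 4 = - \<i> * m"
    by (simp_all add: m_def mu_def omega_2 omega_3 omega_4)
  have entry: "(W \<alpha> x ** W_inv \<alpha> x) $ i $ j =
     (\<Sum>q\<in>UNIV. mu \<alpha> q ^ (pos i - 1) * mu \<alpha> q ^ (4 - pos j) / (4 * mu \<alpha> q ^ 3))" for i j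
    unfolding matrix_matrix_mult_def W_nth W_inv_def
    by (simp add: exp_minus field_simps)
  show ?thesis
    unfolding vec_eq_iff mat_def forall_4
    using m0 by (simp add: entry sum_4 mu power_mult_distrib divide_simps eval_nat_numeral) (simp add: algebra_simps)
qed

lemma W_inv_mult_W: "\<alpha> \<noteq> 0 \<Longrightarrow> W_inv \<alpha> x ** W \<alpha> x = mat 1"
  using W_mult_W_inv matrix_left_right_inverse by blast

lemma W_W_inv_vec: "\<alpha> \<noteq> 0 \<Longrightarrow> W \<alpha> x *v (W_inv \<alpha> x *v v) = v"
  by (simp add: matrix_vector_mul_assoc W_mult_W_inv)

lemma W_inv_W_vec: "\<alpha> \<noteq> 0 \<Longrightarrow> W_inv \<alpha> x *v (W \<alpha> x *v v) = v"
  by (simp add: matrix_vector_mul_assoc W_inv_mult_W)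

lemma W_inv_vec_nth:
  "(W_inv \<alpha> x *v v) $ q = exp (- mu \<alpha> q * of_real x) *
      ((mu \<alpha> q ^ 3 * v $ 1 + mu \<alpha> q ^ 2 * v $ 2 + mu \<alpha> q * v $ 3 + v $ 4) / (4 * mu \<alpha> q ^ 3))"
  by (simp add: matrix_vector_mult_def W_inv_def sum_4 add_divide_distrib algebra_simps)

section \<open>Variation of parameters\<close>

text \<open>\<open>U\<close> is the jet \<open>(u, u', u'', u''')\<close> of a solution of \<open>u'''' = c u\<close> on \<open>S\<close>.\<close>

definition ode_jet :: "complex \<Rightarrow> real set \<Rightarrow> (real \<Rightarrow> complex^4) \<Rightarrow> bool" where
  "ode_jet c S U \<longleftrightarrow> (\<forall>x\<in>S.
     ((\<lambda>x. U x $ 1) has_vector_derivative U x $ 2) (at x within S) \<and>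
     ((\<lambda>x. U x $ 2) has_vector_derivative U x $ 3) (at x within S) \<and>
     ((\<lambda>x. U x $ 3) has_vector_derivative U x $ 4) (at x within S) \<and>
     ((\<lambda>x. U x $ 4) has_vector_derivative c * U x $ 1) (at x within S))"

lemma exp_has_vector_derivative:
  fixes b :: complex
  shows "((\<lambda>x. exp (b * of_real x)) has_vector_derivative b * exp (b * of_real x)) (at x within S)"
proof -
  have "((\<lambda>z. exp (b * z)) has_field_derivative b * exp (b * of_real x)) (at (of_real x))"
    by (auto intro!: derivative_eq_intros)
  from has_vector_derivative_real_field[OF this] show ?thesis .
qed

text \<open>With m = \<open>mu \<alpha> q\<close>, the terms in u', u'', u''' cancel in the product
  rule. What remains is u'''' - m^4 u = (c + \<alpha>^4) u, times the exponential and the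
  normalising constant.\<close>

lemma W_inv_jet_has_vector_derivative:
  assumes "ode_jet c S U" "x \<in> S" "\<alpha> \<noteq> 0"
  shows "((\<lambda>x. (W_inv \<alpha> x *v U x) $ q) has_vector_derivative
           (c + of_real (\<alpha> ^ 4)) / (4 * mu \<alpha> q ^ 3) * exp (- mu \<alpha> q * of_real x) * U x $ 1)
         (at x within S)"
proof -
  let ?m = "mu \<alpha> q"
  have D: "((\<lambda>x. (?m ^ 3 * U x $ 1 + ?m ^ 2 * U x $ 2 + ?m * U x $ 3 + U x $ 4) / (4 * ?m ^ 3))
     has_vector_derivative
      (?m ^ 3 * U x $ 2 + ?m ^ 2 * U x $ 3 + ?m * U x $ 4 + c * U x $ 1) / (4 * ?m ^ 3)) (at x within S)"
    using assms unfolding ode_jet_def by (auto intro!: derivative_intros)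
  have pow: "of_real (\<alpha> ^ 4) = - (?m ^ 4)"
    using mu_power4[of \<alpha> q] by simp
  have m0: "?m \<noteq> 0" using assms by (simp add: mu_nonzero)
  show ?thesis
    unfolding W_inv_vec_nth pow
    by (rule has_vector_derivative_eq_rhs[OF has_vector_derivative_mult[OF exp_has_vector_derivative D]])
       (use m0 in \<open>simp add: field_simps eval_nat_numeral\<close>)
qed

lemma W_inv_jet_constant:
  assumes "ode_jet (- of_real (\<alpha> ^ 4)) {a..b} U" "\<alpha> \<noteq> 0" "x \<in> {a..b}"
  shows "W_inv \<alpha> x *v U x = W_inv \<alpha> a *v U a"
proof -
  have "(W_inv \<alpha> x *v U x) $ q = (W_inv \<alpha> a *v U a) $ q" for q
  proof (rule has_derivative_zero_unique[of "{a..b}"])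
    show "((\<lambda>x. (W_inv \<alpha> x *v U x) $ q) has_derivative (\<lambda>h. 0)) (at x within {a..b})"
      if "x \<in> {a..b}" for x
      using W_inv_jet_has_vector_derivative[OF assms(1) that assms(2), of q]
      by (simp add: has_vector_derivative_def)
  qed (use assms(3) in auto)
  then show ?thesis by (simp add: vec_eq_iff)
qed

section \<open>A criterion for well-posedness\<close>

lemma M_tilde_vec:
  "M_tilde l \<alpha> M *v a = left_block M *v (W \<alpha> (- l) *v a) + right_block M *v (W \<alpha> l *v a)"
  by (simp add: M_tilde_def M_tilde_minus_def M_tilde_plus_def matrix_vector_mult_add_rdistrib
      matrix_vector_mul_assoc)

lemma block_mult_vec:
  "M *v v = left_block M *v (\<chi> p. v $ Inl p) + right_block M *v (\<chi> p. v $ Inr p)"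
  by (simp add: vec_eq_iff matrix_vector_mult_def left_block_def right_block_def
      UNIV_Plus_UNIV[symmetric] sum.Plus del: UNIV_Plus_UNIV)

lemma ode_jet_nderiv:
  assumes "u \<in> C_on l 4" and "\<And>x. x \<in> {-l..l} \<Longrightarrow> nderiv l 4 u x = c * u x"
  shows "ode_jet c {-l..l} (\<lambda>x. \<chi> p. nderiv l (pos p - 1) u x)"
proof -
  have "(nderiv l i u has_vector_derivative nderiv l (Suc i) u x) (at x within {-l..l})"
    if "i < 4" "x \<in> {-l..l}" for i x
    using assms(1) that
    by (auto simp: C_on_def nderiv_def differentiable_on_def vector_derivative_works[symmetric])
  from this[of 0] this[of 1] this[of 2] this[of 3]
  have "x \<in> {-l..l} \<Longrightarrow> (nderiv l 0 u has_vector_derivative nderiv l 1 u x) (at x within {-l..l})"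
    "x \<in> {-l..l} \<Longrightarrow> (nderiv l 1 u has_vector_derivative nderiv l 2 u x) (at x within {-l..l})"
    "x \<in> {-l..l} \<Longrightarrow> (nderiv l 2 u has_vector_derivative nderiv l 3 u x) (at x within {-l..l})"
    "x \<in> {-l..l} \<Longrightarrow> (nderiv l 3 u has_vector_derivative nderiv l 4 u x) (at x within {-l..l})" for x
    by (simp_all add: eval_nat_numeral)
  then show ?thesis
    unfolding ode_jet_def using assms(2) by (simp add: nderiv_def)
qed

text \<open>The jet of a solution is W(x) a with a constant vector a, so the boundary condition
  reads \<open>M_tilde l \<alpha> M *v a = 0\<close> and forces a = 0.\<close>

lemma wp_if_invertible:
  assumes "\<alpha> \<noteq> 0" "l > 0" and inv: "invertible (M_tilde l \<alpha> M)"
  shows "M \<in> wp l \<alpha>"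
proof -
  have "u x = 0" if "u \<in> C_on l 4" "\<forall>x\<in>{-l..l}. nderiv l 4 u x + of_real (\<alpha> ^ 4) * u x = 0"
    "M *v bdry l u = 0" "x \<in> {-l..l}" for u x
  proof -
    define U where "U = (\<lambda>x. \<chi> p. nderiv l (pos p - 1) u x)"
    have "ode_jet (- of_real (\<alpha> ^ 4)) {-l..l} U"
      unfolding U_def using that by (intro ode_jet_nderiv) (auto simp: eq_neg_iff_add_eq_0)
    note const = W_inv_jet_constant[OF this assms(1)]
    define a where "a = W_inv \<alpha> (- l) *v U (- l)"
    have U: "U x = W \<alpha> x *v a" if "x \<in> {-l..l}" for x
      using const[OF that] W_W_inv_vec[OF assms(1)] by (metis a_def)
    have "M_tilde l \<alpha> M *v a = M *v bdry l u"
      using assms(2) U[of l] U[of "- l"]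
      by (simp add: M_tilde_vec block_mult_vec[of M] bdry_def U_def)
    with that inv have "a = 0"
      by (metis invertible_left_inverse matrix_left_invertible_ker)
    with U[OF that(4)] have "U x $ 1 = 0" by simp
    then show ?thesis by (simp add: U_def nderiv_def)
  qed
  then show ?thesis by (auto simp: wp_def)
qed

section \<open>Real solutions with different coefficients at the two ends\<close>

text \<open>Meant for \<open>Re\<close> and \<open>Im\<close>, followed by the embedding into the
  complex numbers: these commute with multiplication by a real c.\<close>

lemma ode_jet_map:
  assumes "ode_jet c S U" "bounded_linear f" "\<And>z. f (c * z) = c * f z"
  shows "ode_jet c S (\<lambda>x. \<chi> p. f (U x $ p))"
  using assms(1) unfolding ode_jet_def
  by (auto simp: assms(3)[symmetric] intro!: bounded_linear.has_vector_derivative[OF assms(2)])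

lemma ode_jet_exp: "ode_jet (\<beta> ^ 4) S (\<lambda>x. \<chi> p. \<beta> ^ (pos p - 1) * exp (\<beta> * of_real x))"
proof -
  have *: "((\<lambda>x. \<beta> ^ n * exp (\<beta> * of_real x)) has_vector_derivative
      \<beta> ^ Suc n * exp (\<beta> * of_real x)) (at x within S)" for n x
    using has_vector_derivative_mult_right[OF exp_has_vector_derivative, of "\<beta> ^ n" \<beta> x S]
    by (simp add: mult_ac)
  show ?thesis
    using *[of 0] *[of 1] *[of 2] *[of 3] unfolding ode_jet_def
    by (simp add: eval_nat_numeral mult_ac)
qed

lemma exists_mu_Re_neq:
  assumes "\<alpha> > 0"
  obtains q where "Re (mu \<alpha> q) \<noteq> r"
proof -
  have "Re (mu \<alpha> 1) \<noteq> Re (mu \<alpha> 3)"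
    using assms Re_omega_1 by (simp add: mu_def omega_3)
  with that show ?thesis by metis
qed

lemma W_inv_exp_jet_ends_neq:
  assumes "\<alpha> > 0" "l > 0" "\<beta> ^ 4 \<noteq> - of_real (\<alpha> ^ 4)"
    and U: "U = (\<lambda>x. \<chi> p. \<beta> ^ (pos p - 1) * exp (\<beta> * of_real x))"
  shows "W_inv \<alpha> l *v U l \<noteq> W_inv \<alpha> (- l) *v U (- l)"
proof
  assume eq: "W_inv \<alpha> l *v U l = W_inv \<alpha> (- l) *v U (- l)"
  \<comment> \<open>Different real parts make the modulus of e^((\<beta> -
    \<open>mu \<alpha> q\<close>) x) differ at l and -l.\<close>
  obtain q where q: "Re (mu \<alpha> q) \<noteq> Re \<beta>" using exists_mu_Re_neq[OF assms(1)] .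
  let ?m = "mu \<alpha> q"
  define \<kappa> where "\<kappa> = (?m ^ 3 + ?m ^ 2 * \<beta> + ?m * \<beta> ^ 2 + \<beta> ^ 3) / (4 * ?m ^ 3)"
  have "(\<beta> - ?m) * (?m ^ 3 + ?m ^ 2 * \<beta> + ?m * \<beta> ^ 2 + \<beta> ^ 3) = \<beta> ^ 4 - ?m ^ 4"
    by (simp add: algebra_simps eval_nat_numeral)
  also have "\<dots> \<noteq> 0" using assms(3) by (simp add: mu_power4 add_eq_0_iff2)
  finally have "\<kappa> \<noteq> 0" using assms(1) by (auto simp: \<kappa>_def mu_nonzero)
  have "(W_inv \<alpha> x *v U x) $ q = \<kappa> * exp ((\<beta> - ?m) * of_real x)" for x
  proof -
    have "exp ((\<beta> - ?m) * of_real x) = exp (- ?m * of_real x) * exp (\<beta> * of_real x)"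
      by (simp add: exp_add[symmetric] algebra_simps)
    then show ?thesis
      unfolding W_inv_vec_nth \<kappa>_def by (simp add: U distrib_left distrib_right mult_ac)
  qed
  with eq \<open>\<kappa> \<noteq> 0\<close> have "exp ((\<beta> - ?m) * of_real l) = exp ((\<beta> - ?m) * of_real (- l))"
    by (metis mult_left_cancel)
  then have "norm (exp ((\<beta> - ?m) * of_real l)) = norm (exp ((\<beta> - ?m) * of_real (- l)))"
    by simp
  with assms(2) q show False by (simp add: left_diff_distrib)
qed

lemma exists_real_jet:
  assumes "\<alpha> > 0" "l > 0" "c \<noteq> - (\<alpha> ^ 4)"
  obtains U where "ode_jet (of_real c) S U" "\<And>x p. U x $ p \<in> \<real>"
    "W_inv \<alpha> l *v U l \<noteq> W_inv \<alpha> (- l) *v U (- l)"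
proof -
  define \<beta> where "\<beta> = csqrt (csqrt (of_real c))"
  have "\<beta> ^ 4 = (\<beta> ^ 2) ^ 2" by simp
  then have \<beta>: "\<beta> ^ 4 = of_real c" by (simp add: \<beta>_def)
  define U where "U = (\<lambda>x. \<chi> p::4. \<beta> ^ (pos p - 1) * exp (\<beta> * of_real x))"
  define R where "R = (\<lambda>x. \<chi> p::4. complex_of_real (Re (U x $ p)))"
  define J where "J = (\<lambda>x. \<chi> p::4. complex_of_real (Im (U x $ p)))"
  have jet: "ode_jet (of_real c) S U" using ode_jet_exp[of \<beta> S] by (simp add: \<beta> U_def)
  have R: "ode_jet (of_real c) S R" unfolding R_def
    by (rule ode_jet_map[OF jet])
       (auto intro: bounded_linear_compose[OF bounded_linear_of_real bounded_linear_Re])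
  have J: "ode_jet (of_real c) S J" unfolding J_def
    by (rule ode_jet_map[OF jet])
       (auto intro: bounded_linear_compose[OF bounded_linear_of_real bounded_linear_Im])
  have split: "U x = R x + \<i> *s J x" for x
    by (simp add: vec_eq_iff R_def J_def complex_eq)
  have "\<beta> ^ 4 \<noteq> - of_real (\<alpha> ^ 4)"
    using assms(3) unfolding \<beta> of_real_minus[symmetric] of_real_eq_iff .
  then have "W_inv \<alpha> l *v U l \<noteq> W_inv \<alpha> (- l) *v U (- l)"
    using W_inv_exp_jet_ends_neq[OF assms(1,2) _ U_def] by blast
  \<comment> \<open>\<open>W_inv\<close> acts complex linearly: if the ends agreed for both R and J,
    they would agree for U = R + iJ.\<close>
  then have "W_inv \<alpha> l *v R l \<noteq> W_inv \<alpha> (- l) *v R (- l) \<or>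
      W_inv \<alpha> l *v J l \<noteq> W_inv \<alpha> (- l) *v J (- l)"
    by (auto simp: split matrix_vector_right_distrib vector_scalar_commute)
  with that[OF R] that[OF J] show ?thesis by (auto simp: R_def J_def)
qed

section \<open>The Green's function integral and eigenfunctions\<close>

lemma integral_if_le:
  fixes g h :: "real \<Rightarrow> complex"
  assumes x: "x \<in> {a..b}"
    and G: "\<And>\<xi>. \<xi> \<in> {a..b} \<Longrightarrow> (G has_vector_derivative g \<xi>) (at \<xi> within {a..b})"
    and H: "\<And>\<xi>. \<xi> \<in> {a..b} \<Longrightarrow> (H has_vector_derivative h \<xi>) (at \<xi> within {a..b})"
    and cont: "continuous_on {a..b} g" "continuous_on {a..b} h"
  shows "(LINT \<xi> | lebesgue_on {a..b}. (if x \<le> \<xi> then g \<xi> else h \<xi>)) = (G b - G x) + (H x - H a)"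
proof -
  let ?f = "\<lambda>\<xi>. if x \<le> \<xi> then g \<xi> else h \<xi>"
  have "{a..b} \<inter> {x..} \<in> sets lebesgue" "{a..b} \<inter> {..<x} \<in> sets lebesgue" by auto
  then have sets: "{a..b} \<inter> {x..} \<in> sets (lebesgue_on {a..b})"
      "{a..b} \<inter> {..<x} \<in> sets (lebesgue_on {a..b})"
    by (auto simp: sets_restrict_space)
  have "integrable (lebesgue_on {a..b})
     (\<lambda>\<xi>. indicator ({a..b} \<inter> {x..}) \<xi> *\<^sub>R g \<xi> + indicator ({a..b} \<inter> {..<x}) \<xi> *\<^sub>R h \<xi>)"
    by (intro Bochner_Integration.integrable_add integrable_mult_indicator sets
        continuous_imp_integrable_real cont)
  also have "?this \<longleftrightarrow> integrable (lebesgue_on {a..b}) ?f"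
    by (rule Bochner_Integration.integrable_cong) (auto simp: indicator_def)
  finally have int: "integrable (lebesgue_on {a..b}) ?f" .
  have "(g has_integral G b - G x) {x..b}"
    using x by (intro fundamental_theorem_of_calculus has_vector_derivative_within_subset[OF G]) auto
  then have 1: "(?f has_integral G b - G x) {x..b}"
    by (rule has_integral_eq[rotated]) auto
  have "(h has_integral H x - H a) {a..x}"
    using x by (intro fundamental_theorem_of_calculus has_vector_derivative_within_subset[OF H]) auto
  \<comment> \<open>At \<xi> = x the integrand takes the value of g instead of h; one point does not
    affect the integral.\<close>
  then have 2: "(?f has_integral H x - H a) {a..x}"
    by (rule has_integral_spike_finite[of "{x}", rotated 2]) auto
  have "(?f has_integral (H x - H a) + (G b - G x)) {a..b}"
    using has_integral_combine[OF _ _ 2 1] x by auto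
  then show ?thesis
    using lebesgue_integral_eq_integral[OF int] by (simp add: integral_unique add.commute)
qed

text \<open>\<open>L_sq\<close> exchanges q and q + 2, and \<open>omega\<close> changes sign under
  this shift, which flips the exponent.\<close>

lemma Omega_L_sq_y_vec_nth:
  "((Omega ** L_sq) *v y_vec \<alpha> x) $ q = omega (int (pos q)) * exp (- mu \<alpha> q * of_real x)"
proof -
  have "\<forall>q. ((Omega ** L_sq) *v y_vec \<alpha> x) $ q = omega (int (pos q)) * exp (- mu \<alpha> q * of_real x)"
    unfolding matrix_vector_mul_assoc[symmetric] forall_4
    by (simp add: matrix_vector_mult_def Omega_def L_sq_def sum_4 y_vec_nth mu_def omega_2 omega_3 omega_4)
  then show ?thesis by blast
qed

lemma bilin_mult: "bilin v (A ** B) w = bilin v A (B *v w)"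
  by (simp add: bilin_def matrix_vector_mul_assoc)

lemma bilin_has_vector_derivative:
  assumes "\<And>q. ((\<lambda>x. a x $ q) has_vector_derivative a' $ q) (at x within S)"
  shows "((\<lambda>x. bilin v A (a x)) has_vector_derivative bilin v A a') (at x within S)"
  unfolding bilin_def matrix_vector_mult_def
  using assms by (auto intro!: derivative_intros)

lemma continuous_on_bilin:
  assumes "\<And>q. continuous_on S (\<lambda>x. a x $ q)"
  shows "continuous_on S (\<lambda>x. bilin v A (a x))"
  unfolding bilin_def matrix_vector_mult_def vec_lambda_beta
  by (intro continuous_intros assms)

lemma bilin_mult_scalar: "bilin v A (c *s w) = c * bilin v A w"
  by (simp add: bilin_def vector_scalar_commute sum_distrib_left mult_ac)

lemma continuous_on_y_vec: "continuous_on S (\<lambda>x. y_vec \<alpha> x $ q)"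
  unfolding y_vec_nth by (intro continuous_intros)

text \<open>Integrating the two branches leaves \<mu> y(x)^T a(x), which is \<mu> u(x), minus a term
  in a(l) and a(-l) that \<open>bc\<close> annihilates. The hypothesis \<open>neq\<close> makes u
  nonzero in \<open>L2 l\<close>.\<close>

lemma eigenvalue_K_op:
  fixes l \<alpha> k \<mu> :: real
  assumes pos: "l > 0" "\<alpha> > 0" "k > 0" "\<mu> \<noteq> 0"
    and inv: "invertible (M_tilde l \<alpha> M)"
    and jet: "ode_jet (of_real (\<alpha> ^ 4 / (k * \<mu>) - \<alpha> ^ 4)) {-l..l} U"
    and bc: "left_block M *v U (- l) + right_block M *v U l = 0"
    and neq: "W_inv \<alpha> l *v U l \<noteq> W_inv \<alpha> (- l) *v U (- l)"
  shows "of_real \<mu> \<in> Spec l (K_op l \<alpha> k M)"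
proof -
  define u where "u = (\<lambda>x. U x $ 1)"
  define a where "a = (\<lambda>x. W_inv \<alpha> x *v U x)"
  define \<kappa> where "\<kappa> = complex_of_real (\<alpha> / (4 * k))"
  define J where "J = Omega ** L_sq"
  have U: "U x = W \<alpha> x *v a x" for x
    using pos by (simp add: a_def W_W_inv_vec)
  have "((\<lambda>x. U x $ 1) has_vector_derivative U x $ 2) (at x within {-l..l})" if "x \<in> {-l..l}" for x
    using jet that by (auto simp: ode_jet_def)
  then have cont_u: "continuous_on {-l..l} u"
    unfolding u_def by (meson continuous_on_vector_derivative)
  have deriv_a: "((\<lambda>x. - of_real \<mu> * a x $ q) has_vector_derivative (\<kappa> * u x) * (J *v y_vec \<alpha> x) $ q)
      (at x within {-l..l})" if x: "x \<in> {-l..l}" for x q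
  proof -
    \<comment> \<open>Since the fourth power of \<open>omega\<close> is -1, dividing by
      \<open>mu \<alpha> q\<close>^3 amounts to multiplying by -\<open>omega\<close>/\<alpha>^3.
      This produces the factor \<Omega> in the Green's function.\<close>
    have m3: "mu \<alpha> q ^ 3 = - of_real (\<alpha> ^ 3) / omega (int (pos q))"
      using omega_pos_power4[of q] omega_nonzero[of "int (pos q)"]
      by (simp add: mu_def power_mult_distrib field_simps eval_nat_numeral)
    have coef: "- of_real \<mu> * ((of_real (\<alpha> ^ 4 / (k * \<mu>) - \<alpha> ^ 4) + of_real (\<alpha> ^ 4)) / (4 * mu \<alpha> q ^ 3))
        = \<kappa> * omega (int (pos q))"
      unfolding m3 \<kappa>_def using pos omega_nonzero[of "int (pos q)"]
      by (simp add: field_simps eval_nat_numeral)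
    note D = has_vector_derivative_mult_right
      [OF W_inv_jet_has_vector_derivative[OF jet x, of \<alpha> q], of "- of_real \<mu>"]
    show ?thesis
      unfolding a_def J_def Omega_L_sq_y_vec_nth
    proof (rule has_vector_derivative_eq_rhs[OF D])
      have *: "- of_real \<mu> * (C * E * U x $ 1) = (- of_real \<mu> * C) * (E * U x $ 1)" for C E :: complex
        by simp
      show "- of_real \<mu> * ((of_real (\<alpha> ^ 4 / (k * \<mu>) - \<alpha> ^ 4) + of_real (\<alpha> ^ 4)) /
           (4 * mu \<alpha> q ^ 3) * exp (- mu \<alpha> q * of_real x) * U x $ 1) =
         \<kappa> * u x * (omega (int (pos q)) * exp (- mu \<alpha> q * of_real x))"
        unfolding * coef by (simp add: u_def mult_ac)
    qed (use pos in simp)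
  qed
  define P where "P = (\<lambda>N :: complex^4^4. matrix_inv (M_tilde l \<alpha> M) ** N)"
  define Pp where "Pp = P (M_tilde_plus l \<alpha> M)"
  define Pm where "Pm = P (M_tilde_minus l \<alpha> M)"
  have "K_op l \<alpha> k M u x = of_real \<mu> * u x" if x: "x \<in> {-l..l}" for x
  proof -
    let ?\<Phi> = "\<lambda>N \<xi>. bilin (y_vec \<alpha> x) N (\<chi> q. - of_real \<mu> * a \<xi> $ q)"
    let ?\<phi> = "\<lambda>N \<xi>. bilin (y_vec \<alpha> x) N (\<chi> q. (\<kappa> * u \<xi>) * (J *v y_vec \<alpha> \<xi>) $ q)"
    have \<phi>: "?\<phi> N \<xi> = \<kappa> * u \<xi> * bilin (y_vec \<alpha> x) (N ** J) (y_vec \<alpha> \<xi>)" for N \<xi>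
      unfolding bilin_mult bilin_mult_scalar[symmetric] by (simp add: vector_scalar_mult_def)
    have \<Phi>: "?\<Phi> N \<xi> = - of_real \<mu> * bilin (y_vec \<alpha> x) N (a \<xi>)" for N \<xi>
      unfolding bilin_mult_scalar[symmetric] by (simp add: vector_scalar_mult_def)
    have D: "(?\<Phi> N has_vector_derivative ?\<phi> N \<xi>) (at \<xi> within {-l..l})" if "\<xi> \<in> {-l..l}" for N \<xi>
      by (rule bilin_has_vector_derivative) (simp only: vec_lambda_beta, rule deriv_a[OF that])
    have C: "continuous_on {-l..l} (?\<phi> N)" for N
      unfolding \<phi> by (intro continuous_intros cont_u continuous_on_bilin continuous_on_y_vec)
    have "K_op l \<alpha> k M u x =
        (LINT \<xi> | lebesgue_on {-l..l}. (if x \<le> \<xi> then ?\<phi> Pp \<xi> else - ?\<phi> Pm \<xi>))"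
      unfolding \<phi> unfolding K_op_def green_def Pp_def Pm_def P_def J_def G_plus_def G_minus_def
      by (intro Bochner_Integration.integral_cong) (auto simp: \<kappa>_def matrix_mul_assoc)
    also have "\<dots> = (?\<Phi> Pp l - ?\<Phi> Pp x) + (- ?\<Phi> Pm x - (- ?\<Phi> Pm (- l)))"
      by (rule integral_if_le[where G = "?\<Phi> Pp" and H = "\<lambda>\<xi>. - ?\<Phi> Pm \<xi>"])
         (rule x D C has_vector_derivative_minus continuous_on_minus | assumption)+
    also have "\<dots> = of_real \<mu> * bilin (y_vec \<alpha> x) (Pp + Pm) (a x)
        - of_real \<mu> * (bilin (y_vec \<alpha> x) Pp (a l) + bilin (y_vec \<alpha> x) Pm (a (- l)))"
      unfolding \<Phi> by (simp add: bilin_def matrix_vector_mult_add_rdistrib sum.distrib algebra_simps)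
    also have "Pp + Pm = mat 1"
    proof -
      have "Pp + Pm = matrix_inv (M_tilde l \<alpha> M) ** M_tilde l \<alpha> M"
        unfolding Pp_def Pm_def P_def M_tilde_def by (simp add: matrix_add_ldistrib add.commute)
      also have "\<dots> = mat 1"
        using inv unfolding invertible_def matrix_inv_def by (metis (mono_tags, lifting) someI_ex)
      finally show ?thesis .
    qed
    also have "bilin (y_vec \<alpha> x) Pp (a l) + bilin (y_vec \<alpha> x) Pm (a (- l)) =
        bilin (y_vec \<alpha> x) (matrix_inv (M_tilde l \<alpha> M)) (left_block M *v U (- l) + right_block M *v U l)"
      unfolding U Pp_def Pm_def P_def M_tilde_minus_def M_tilde_plus_def bilin_mult
      by (simp add: bilin_def matrix_vector_right_distrib sum.distrib algebra_simps matrix_vector_mul_assoc)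
    also have "\<dots> = 0"
      unfolding bc by (simp add: bilin_def)
    \<comment> \<open>y(x) is the first row of W(x).\<close>
    also have "bilin (y_vec \<alpha> x) (mat 1) (a x) = u x"
      unfolding u_def U by (simp add: bilin_def matrix_vector_mult_def[of "W _ _"] W_nth y_vec_nth)
    finally show ?thesis by simp
  qed
  then have eig: "AE x in lebesgue_on {-l..l}. K_op l \<alpha> k M u x = of_real \<mu> * u x"
    by (intro AE_I2) simp
  \<comment> \<open>If u vanished almost everywhere, so would the derivative of a, and integrating
    it would give a(l) = a(-l).\<close>
  have "\<not> (AE x in lebesgue_on {-l..l}. u x = 0)"
  proof
    assume ae: "AE x in lebesgue_on {-l..l}. u x = 0"
    have "a l $ q = a (- l) $ q" for q
    proof -
      let ?g = "\<lambda>x. (\<kappa> * u x) * (J *v y_vec \<alpha> x) $ q"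
      have "continuous_on {-l..l} ?g"
        unfolding J_def Omega_L_sq_y_vec_nth by (intro continuous_intros cont_u)
      note int = continuous_imp_integrable_real[OF this]
      have "(?g has_integral - of_real \<mu> * a l $ q - (- of_real \<mu> * a (- l) $ q)) {-l..l}"
        using pos by (intro fundamental_theorem_of_calculus deriv_a) auto
      then have "integral\<^sup>L (lebesgue_on {-l..l}) ?g = - of_real \<mu> * a l $ q - (- of_real \<mu> * a (- l) $ q)"
        using lebesgue_integral_eq_integral[OF int] by (simp add: integral_unique)
      moreover have "integral\<^sup>L (lebesgue_on {-l..l}) ?g = 0"
      proof (rule integral_eq_zero_AE)
        show "AE x in lebesgue_on {-l..l}. ?g x = 0"
          using ae by eventually_elim simp
      qed
      ultimately show ?thesis using pos by simp
    qed
    with neq show False by (simp add: vec_eq_iff a_def)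
  qed
  moreover have "u \<in> L2 l"
    using borel_measurable_integrable[OF continuous_imp_integrable_real[OF cont_u]]
      continuous_imp_integrable_real[OF continuous_on_power[OF continuous_on_norm[OF cont_u]]]
    by (simp add: L2_def)
  ultimately show ?thesis
    using eig unfolding Spec_def by blast
qed

section \<open>Construction of the boundary matrix\<close>

definition dot :: "complex^4 \<Rightarrow> complex^4 \<Rightarrow> complex" where
  "dot v w = (\<Sum>p\<in>UNIV. v $ p * w $ p)"

definition outer :: "complex^4 \<Rightarrow> complex^4 \<Rightarrow> complex^4^4" where
  "outer v w = (\<chi> i j. v $ i * w $ j)"

lemma outer_vec: "outer v w *v x = dot w x *s v"
  by (simp add: vec_eq_iff outer_def dot_def matrix_vector_mult_def sum_distrib_left mult_ac)

lemma dot_scalar: "dot v (c *s w) = c * dot v w"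
  by (simp add: dot_def sum_distrib_left mult_ac)

lemma dot_axis: "dot (axis i c) v = c * v $ i"
  by (simp add: dot_def axis_def if_distrib[of "\<lambda>x. x * _"] cong: if_cong)

lemma axis_nth_Reals: "c \<in> \<real> \<Longrightarrow> axis i c $ p \<in> (\<real> :: complex set)"
  by (simp add: axis_def)

lemma dot_zero_left: "dot 0 v = 0"
  by (simp add: dot_def)

text \<open>
  The assumption on \<open>b = 0\<close> ensures that some coordinate functional other than \<open>j\<close>, where \<open>e\<close> and
  \<open>f\<close> differ, can be used to normalise the value on \<open>(b, e)\<close> when \<open>e $ j = 0\<close>.
\<close>

lemma exists_separating_functional:
  assumes real: "\<And>p. b $ p \<in> \<real>" "\<And>p. e $ p \<in> \<real>"
    and "e \<noteq> f" and zero: "b = 0 \<Longrightarrow> f = 0"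
  obtains r s where "\<And>p. r $ p \<in> \<real>" "\<And>p. s $ p \<in> \<real>"
    "dot r b + dot s e = 1" "dot r b + dot s f \<noteq> 1"
proof -
  obtain j where j: "e $ j \<noteq> f $ j" using assms(3) by (auto simp: vec_eq_iff)
  show ?thesis
  proof (cases "e $ j = 0")
    case False
    show ?thesis
    proof (rule that[of 0 "axis j (1 / e $ j)"])
      show "dot 0 b + dot (axis j (1 / e $ j)) f \<noteq> 1"
        using j False by (simp add: dot_axis dot_zero_left)
    qed (use False real in \<open>auto simp: dot_axis dot_zero_left axis_nth_Reals\<close>)
  next
    case True
    \<comment> \<open>Here f has a nonzero j-th entry, so \<open>zero\<close> excludes b =
      0.\<close>
    with j zero obtain i where i: "b $ i \<noteq> 0" by (auto simp: vec_eq_iff)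
    show ?thesis
    proof (rule that[of "axis i (1 / b $ i)" "axis j 1"])
      show "dot (axis i (1 / b $ i)) b + dot (axis j 1) f \<noteq> 1"
        using j True i by (simp add: dot_axis)
    qed (use True i real in \<open>auto simp: dot_axis axis_nth_Reals\<close>)
  qed
qed

text \<open>
  \<open>M\<close> is a rank one perturbation of the initial value conditions \<open>(I 0)\<close>:
  \<open>M (v, w) = v - (r \<cdot> v + s \<cdot> w) b\<close>, with \<open>(r, s)\<close> equal to \<open>1\<close> on the boundary data of \<open>u\<close> and
  different from \<open>1\<close> on those of the solution of \<open>v'''' = - \<alpha>^4 v\<close> with the same initial values.
\<close>

lemma exists_boundary_matrix:
  assumes "\<alpha> > 0" and real: "\<And>p. U (- l) $ p \<in> \<real>" "\<And>p. U l $ p \<in> \<real>"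
    and neq: "W_inv \<alpha> l *v U l \<noteq> W_inv \<alpha> (- l) *v U (- l)"
  obtains M where "\<And>i j. M $ i $ j \<in> \<real>" "invertible (M_tilde l \<alpha> M)"
    "left_block M *v U (- l) + right_block M *v U l = 0"
proof -
  define b where "b = U (- l)"
  \<comment> \<open>The coefficients of the solution of v'''' = -\<alpha>^4 v with jet b at -l; its
    jet at l is \<open>W \<alpha> l *v c\<close>.\<close>
  define c where "c = W_inv \<alpha> (- l) *v b"
  have Wc: "W \<alpha> (- l) *v c = b" using assms(1) by (simp add: c_def W_W_inv_vec)
  have "U l \<noteq> W \<alpha> l *v c"
    using neq assms(1) W_inv_W_vec by (metis b_def c_def less_irrefl)
  moreover have "b = 0 \<Longrightarrow> W \<alpha> l *v c = 0" by (simp add: c_def)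
  ultimately obtain r s where rs: "\<And>p. r $ p \<in> \<real>" "\<And>p. s $ p \<in> \<real>"
    "dot r b + dot s (U l) = 1" "dot r b + dot s (W \<alpha> l *v c) \<noteq> 1"
    using real exists_separating_functional[of b "U l" "W \<alpha> l *v c"] unfolding b_def by metis
  define M where "M = join_blocks (mat 1 - outer b r) (- outer b s)"
  have blocks: "left_block M = mat 1 - outer b r" "right_block M = - outer b s"
    by (simp_all add: M_def left_block_def right_block_def join_blocks_def vec_eq_iff)
  have act: "left_block M *v v + right_block M *v w = v - (dot r v + dot s w) *s b" for v w
  proof -
    have "(- outer b s) *v w = - (outer b s *v w)"
      by (simp add: vec_eq_iff matrix_vector_mult_def sum_negf)
    then show ?thesis
      unfolding blocks
      by (simp add: matrix_vector_mult_diff_rdistrib outer_vec vector_sadd_rdistrib)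
  qed
  show ?thesis
  proof (rule that[of M])
    show "M $ i $ j \<in> \<real>" for i j
      using real(1) rs(1,2)
      by (auto simp: M_def join_blocks_def outer_def mat_def b_def split: sum.splits)
    show "left_block M *v U (- l) + right_block M *v U l = 0"
      unfolding act by (simp add: b_def[symmetric] rs(3))
    have "a = 0" if a: "M_tilde l \<alpha> M *v a = 0" for a
    proof -
      define t where "t = dot r (W \<alpha> (- l) *v a) + dot s (W \<alpha> l *v a)"
      have "W \<alpha> (- l) *v a = t *s b"
        using a unfolding M_tilde_vec act t_def by simp
      then have at: "a = t *s c"
        using assms(1) W_inv_W_vec[of \<alpha> "- l" a] by (simp add: c_def vector_scalar_commute)
      \<comment> \<open>A kernel vector is t times c. Substituting this into the definition of t
        multiplies t by a factor different from 1, so t = 0.\<close>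
      have "t = t * (dot r b + dot s (W \<alpha> l *v c))"
        by (subst t_def) (simp add: at vector_scalar_commute dot_scalar Wc distrib_left)
      with rs(4) have "t = 0" by simp
      with at show ?thesis by simp
    qed
    then show "invertible (M_tilde l \<alpha> M)"
      by (metis invertible_left_inverse matrix_left_invertible_ker)
  qed
qed

theorem theorem2:
  fixes l \<alpha> k \<mu> :: real
  assumes "l > 0" and "\<alpha> > 0" and "k > 0"
    and "\<mu> \<noteq> 0"
    and "complex_of_real \<mu> \<notin> Spec l (K_op l \<alpha> k (Q \<alpha>))"
  shows "\<exists>M \<in> wp_real l \<alpha>. complex_of_real \<mu> \<in> Spec l (K_op l \<alpha> k M)"
proof -
  have "\<alpha> ^ 4 / (k * \<mu>) - \<alpha> ^ 4 \<noteq> - (\<alpha> ^ 4)"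
    using assms by simp
  from exists_real_jet[OF assms(2,1) this]
  obtain U where U: "ode_jet (of_real (\<alpha> ^ 4 / (k * \<mu>) - \<alpha> ^ 4)) {-l..l} U"
    "\<And>x p. U x $ p \<in> \<real>" "W_inv \<alpha> l *v U l \<noteq> W_inv \<alpha> (- l) *v U (- l)" by metis
  obtain M where M: "\<And>i j. M $ i $ j \<in> \<real>" "invertible (M_tilde l \<alpha> M)"
    "left_block M *v U (- l) + right_block M *v U l = 0"
    using exists_boundary_matrix[where U = U, OF assms(2) U(2) U(2) U(3)] by blast
  have "M \<in> wp_real l \<alpha>"
    using wp_if_invertible[OF _ assms(1) M(2)] M(1) assms(2) by (simp add: wp_real_def)
  moreover have "complex_of_real \<mu> \<in> Spec l (K_op l \<alpha> k M)"
    by (rule eigenvalue_K_op[OF assms(1-4) M(2) U(1) M(3) U(3)])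
  ultimately show ?thesis by blast
qed

end
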